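(* Let $\mathcal{B}$ be an arrangement of $m$ hyperplanes in $\mathbb{C}^{\ell}$, and let $\mathcal{A}$ be an arrangement of $m+n$ hyperplanes in $\mathbb{C}^{\ell+1}$ which is strictly linearly fibered over $\mathcal{B}$, with bundle projection $p:M(\mathcal{A})\to M(\mathcal{B})$, $p(\mathbf{x},z)=\mathbf{x}$, and associated root map $g:M(\mathcal{B})\to F(\mathbb{C},n)$. Then the bundle $p:M(\mathcal{A})\to M(\mathcal{B})$ is equivalent to the pullback along $g$ of the bundle of configuration spaces $p_{n+1}:F(\mathbb{C},n+1)\to F(\mathbb{C},n)$, $(y_1,\dots,y_n,z)\mapsto(y_1,\dots,y_n)$.
   Context: A hyperplane arrangement is a finite collection of codimension one affine subspaces of $\mathbb{C}^{\ell}$; its complement is $M(\mathcal{A})=\mathbb{C}^{\ell}\setminus\bigcup_{H\in\mathcal{A}}H$. The configuration space is $F(\mathbb{C},n)=\{(y_1,\dots,y_n)\in\mathbb{C}^n\mid y_i\neq y_j \text{ if } i\neq j\}$. An arrangement $\mathcal{A}$ in $\mathbb{C}^{\ell+1}$ is strictly linearly fibered over an arrangement $\mathcal{B}$ in $\mathbb{C}^{\ell}$ if there is a choice of coordinates $(\mathbf{x},z)=(x_1,\dots,x_\ell,z)$ on $\mathbb{C}^{\ell+1}$ so that the restriction $p$ of the projection $(\mathbf{x},z)\mapsto\mathbf{x}$ to $M(\mathcal{A})$ is a fiber bundle projection with base $p(M(\mathcal{A}))=M(\mathcal{B})$ and fiber the complement of finitely many points in $\mathbb{C}$. In this situation, with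 $|\mathcal{B}|=m$ and $|\mathcal{A}|=m+n$, a defining polynomial of $\mathcal{A}$ factors as $Q(\mathcal{A})=Q(\mathcal{B})(\mathbf{x})\cdot\phi(\mathbf{x},z)$, where $Q(\mathcal{B})$ is a defining polynomial of $\mathcal{B}$ and $\phi(\mathbf{x},z)=\prod_{j=1}^n(z-g_j(\mathbf{x}))$ with each $g_j$ (affine) linear. Since $\phi(\mathbf{x},\cdot)$ has distinct roots for every $\mathbf{x}\in M(\mathcal{B})$, the root map $g(\mathbf{x})=(g_1(\mathbf{x}),\dots,g_n(\mathbf{x}))$ takes $M(\mathcal{B})$ into $F(\mathbb{C},n)$. *)

theory Defs
  imports "HOL-Analysis.Analysis" "HOL-Library.Function_Algebras"
begin

text \<open>
  The space \<open>\<complex>\<^sup>k\<close> is the set of sequences supported on \<open>{..<k}\<close>, so that the dimension is an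
  ordinary natural number (zero included). The subspace topology inherited from
  the product topology on \<open>nat \<Rightarrow> complex\<close> is the usual topology of \<open>\<complex>\<^sup>k\<close>. Indices start at 0.
\<close>

definition cspace :: "nat \<Rightarrow> (nat \<Rightarrow> complex) set" where
  "cspace k = {x. \<forall>i\<ge>k. x i = 0}"

definition trunc :: "nat \<Rightarrow> (nat \<Rightarrow> complex) \<Rightarrow> nat \<Rightarrow> complex" where
  "trunc k x = (\<lambda>i. if i < k then x i else 0)"

definition cscale :: "complex \<Rightarrow> (nat \<Rightarrow> complex) \<Rightarrow> nat \<Rightarrow> complex" where
  "cscale c x = (\<lambda>i. c * x i)"

global_interpretation cvec: vector_space cscale
  by standard (auto simp: cscale_def fun_eq_iff algebra_simps)

definition hyperplane :: "nat \<Rightarrow> (nat \<Rightarrow> complex) set \<Rightarrow> bool" where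
  "hyperplane k H \<longleftrightarrow>
     (\<exists>v W. v \<in> cspace k \<and> cvec.subspace W \<and> W \<subseteq> cspace k \<and> cvec.dim W + 1 = k \<and> H = (+) v ` W)"

definition arrangement :: "nat \<Rightarrow> (nat \<Rightarrow> complex) set set \<Rightarrow> bool" where
  "arrangement k \<A> \<longleftrightarrow> finite \<A> \<and> (\<forall>H\<in>\<A>. hyperplane k H)"

definition arr_complement :: "nat \<Rightarrow> (nat \<Rightarrow> complex) set set \<Rightarrow> (nat \<Rightarrow> complex) set" where
  "arr_complement k \<A> = cspace k - \<Union>\<A>"

definition configuration_space :: "nat \<Rightarrow> (nat \<Rightarrow> complex) set" where
  "configuration_space n = {y \<in> cspace n. inj_on y {..<n}}"

definition affine_function :: "nat \<Rightarrow> ((nat \<Rightarrow> complex) \<Rightarrow> complex) \<Rightarrow> bool" where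
  "affine_function k f \<longleftrightarrow> (\<exists>a b. \<forall>x\<in>cspace k. f x = (\<Sum>i<k. a i * x i) + b)"

text \<open>Polynomials over the infinite field \<open>\<complex>\<close> are identified with polynomial functions.\<close>

definition defining_polynomial ::
    "nat \<Rightarrow> (nat \<Rightarrow> complex) set set \<Rightarrow> ((nat \<Rightarrow> complex) \<Rightarrow> complex) \<Rightarrow> bool" where
  "defining_polynomial k \<A> Q \<longleftrightarrow>
     (\<exists>\<alpha>. (\<forall>H\<in>\<A>. affine_function k (\<alpha> H) \<and> H = {x \<in> cspace k. \<alpha> H x = 0}) \<and>
          (\<forall>x\<in>cspace k. Q x = (\<Prod>H\<in>\<A>. \<alpha> H x)))"

definition fiber_bundle ::
    "('e::topological_space \<Rightarrow> 'b::topological_space) \<Rightarrow> 'e set \<Rightarrow> 'b set \<Rightarrow> 'f::topological_space set \<Rightarrow> bool" where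
  "fiber_bundle p E X F \<longleftrightarrow>
     continuous_on E p \<and> p ` E = X \<and>
     (\<forall>b\<in>X. \<exists>U h h'. openin (top_of_set X) U \<and> b \<in> U \<and>
        homeomorphism {e \<in> E. p e \<in> U} (U \<times> F) h h' \<and>
        (\<forall>e\<in>E. p e \<in> U \<longrightarrow> fst (h e) = p e))"

definition bundle_equivalent ::
    "('e::topological_space \<Rightarrow> 'b) \<Rightarrow> 'e set \<Rightarrow> ('d::topological_space \<Rightarrow> 'b) \<Rightarrow> 'd set \<Rightarrow> bool" where
  "bundle_equivalent p E q D \<longleftrightarrow>
     (\<exists>\<Phi> \<Psi>. homeomorphism E D \<Phi> \<Psi> \<and> (\<forall>e\<in>E. q (\<Phi> e) = p e))"

text \<open>Total space of the pullback of \<open>q : D \<rightarrow> Y\<close> along \<open>f : X \<rightarrow> Y\<close>; its projection to \<open>X\<close> is \<open>fst\<close>.\<close>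

definition pullback_space :: "('b \<Rightarrow> 'c) \<Rightarrow> 'b set \<Rightarrow> ('d \<Rightarrow> 'c) \<Rightarrow> 'd set \<Rightarrow> ('b \<times> 'd) set" where
  "pullback_space f X q D = {(x, d) \<in> X \<times> D. f x = q d}"

text \<open>
  A choice of (affine) coordinates \<open>(\<x>, z)\<close> on \<open>\<complex>\<^sup>l\<^sup>+\<^sup>1\<close> is an affine automorphism \<open>T\<close>:
  the point \<open>v\<close> has \<open>\<x> = trunc l (T v)\<close> and \<open>z = T v l\<close>.
\<close>

definition affine_coordinates :: "nat \<Rightarrow> ((nat \<Rightarrow> complex) \<Rightarrow> nat \<Rightarrow> complex) \<Rightarrow> bool" where
  "affine_coordinates k T \<longleftrightarrow>
     bij_betw T (cspace k) (cspace k) \<and> (\<forall>i<k. affine_function k (\<lambda>v. T v i))"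

definition bundle_projection ::
    "nat \<Rightarrow> ((nat \<Rightarrow> complex) \<Rightarrow> nat \<Rightarrow> complex) \<Rightarrow> (nat \<Rightarrow> complex) \<Rightarrow> nat \<Rightarrow> complex" where
  "bundle_projection l T v = trunc l (T v)"

definition strictly_linearly_fibered_via ::
    "nat \<Rightarrow> ((nat \<Rightarrow> complex) \<Rightarrow> nat \<Rightarrow> complex) \<Rightarrow>
     (nat \<Rightarrow> complex) set set \<Rightarrow> (nat \<Rightarrow> complex) set set \<Rightarrow> bool" where
  "strictly_linearly_fibered_via l T \<A> \<B> \<longleftrightarrow>
     affine_coordinates (Suc l) T \<and>
     (\<exists>S :: complex set. finite S \<and>
        fiber_bundle (bundle_projection l T) (arr_complement (Suc l) \<A>) (arr_complement l \<B>) (- S))"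

text \<open>
  The factorization \<open>Q(\<A>) = Q(\<B>)(\<x>) \<cdot> \<Prod>\<^sub>j (z - g\<^sub>j(\<x>))\<close> with affine \<open>g\<^sub>j\<close>. That the roots
  \<open>g\<^sub>j(\<x>)\<close> are distinct for \<open>\<x>\<close> in the complement of \<open>\<B>\<close> is not part of the definition.
\<close>

definition root_map ::
    "nat \<Rightarrow> nat \<Rightarrow> ((nat \<Rightarrow> complex) \<Rightarrow> nat \<Rightarrow> complex) \<Rightarrow>
     (nat \<Rightarrow> complex) set set \<Rightarrow> (nat \<Rightarrow> complex) set set \<Rightarrow>
     ((nat \<Rightarrow> complex) \<Rightarrow> nat \<Rightarrow> complex) \<Rightarrow> bool" where
  "root_map l n T \<A> \<B> g \<longleftrightarrow>
     (\<forall>x\<in>cspace l. g x \<in> cspace n) \<and>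
     (\<forall>j<n. affine_function l (\<lambda>x. g x j)) \<and>
     (\<exists>QA QB. defining_polynomial (Suc l) \<A> QA \<and> defining_polynomial l \<B> QB \<and>
        (\<forall>v\<in>cspace (Suc l).
           QA v = QB (trunc l (T v)) * (\<Prod>j<n. T v l - g (trunc l (T v)) j)))"

end

theory Submission
  imports Defs
begin

text \<open>
  The factorization of \<open>Q(\<A>)\<close> identifies \<open>M(\<A>)\<close> with the pairs \<open>(\<x>, z)\<close> such that \<open>\<x> \<in> M(\<B>)\<close>
  and \<open>z\<close> is not a root \<open>g\<^sub>j(\<x>)\<close>, so \<open>(\<x>, z) \<mapsto> (\<x>, (g(\<x>), z))\<close> is the required equivalence once the
  roots are known to be distinct over \<open>M(\<B>)\<close>. Counting hyperplanes, \<open>\<bar>\<A>\<bar> = m + n\<close> forces the functions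
  \<open>g\<^sub>j\<close> to be pairwise different, so a generic fiber is \<open>\<complex>\<close> minus exactly \<open>n\<close> points. All fibers of
  the bundle are homeomorphic, and a homeomorphism of punctured planes induces a bijection of their ends, so
  every fiber has exactly \<open>n\<close> punctures.
\<close>

section \<open>Ends of a punctured plane\<close>

text \<open>\<open>None\<close> stands for the puncture at infinity, \<open>Some p\<close> for the
  puncture p. An end is encoded by the filter of its punctured neighbourhoods, so that "f carries
  this end to that end" becomes a \<open>filterlim\<close> statement.\<close>

primrec end_at :: "complex option \<Rightarrow> complex filter" where
  "end_at None = at_infinity"
| "end_at (Some p) = at p"

definition ends :: "complex set \<Rightarrow> complex option set" where
  "ends P = insert None (Some ` P)"

lemma finite_ends: "finite P \<Longrightarrow> finite (ends P)"
  by (simp add: ends_def)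

lemma card_ends: "finite P \<Longrightarrow> card (ends P) = Suc (card P)"
  unfolding ends_def by (subst card_insert_disjoint) (auto simp: card_image)

lemma end_at_ne_bot: "end_at a \<noteq> bot"
  using trivial_limit_at_infinity by (cases a) auto

text \<open>The inequality makes the identity map tend to b along \<open>end_at a\<close>. It also
  tends to a there, and along a nontrivial filter a map cannot have two limits, one of which may be
  infinity.\<close>

lemma end_at_le_imp_eq:
  assumes "end_at a \<le> end_at b"
  shows "a = b"
proof (cases a; cases b)
  fix p q assume ab: "a = Some p" "b = Some q"
  have "((\<lambda>z. z) \<longlongrightarrow> q) (at p)"
    using assms unfolding ab filterlim_def by (simp add: at_within_def le_infI1)
  moreover have "((\<lambda>z. z) \<longlongrightarrow> p) (at p)"
    by (rule tendsto_ident_at)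
  ultimately have "q = p"
    using tendsto_unique trivial_limit_at by blast
  then show ?thesis using ab by simp
next
  fix p assume ab: "a = Some p" "b = None"
  have "filterlim (\<lambda>z. z) at_infinity (at p)"
    using assms unfolding ab filterlim_def by simp
  then show ?thesis
    using not_tendsto_and_filterlim_at_infinity[of "at p" "\<lambda>z. z" p]
    by (simp add: tendsto_ident_at)
next
  fix q assume ab: "a = None" "b = Some q"
  have "((\<lambda>z. z) \<longlongrightarrow> q) at_infinity"
    using assms unfolding ab filterlim_def by (simp add: at_within_def le_infI1)
  moreover have "filterlim (\<lambda>z::complex. z) at_infinity at_infinity"
    by (simp add: filterlim_def)
  ultimately show ?thesis
    using not_tendsto_and_filterlim_at_infinity[of at_infinity "\<lambda>z::complex. z" q]
      trivial_limit_at_infinity[where 'a = complex] by (auto simp: trivial_limit_def)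
qed simp

lemma eventually_end_at_not_compact:
  assumes "compact K" and "\<And>p. a = Some p \<Longrightarrow> p \<notin> K"
  shows "\<forall>\<^sub>F z in end_at a. z \<notin> K"
proof (cases a)
  case None
  obtain b where "\<forall>z\<in>K. norm z \<le> b"
    using compact_imp_bounded[OF assms(1)] bounded_iff by blast
  then have "\<forall>z. norm z \<ge> b + 1 \<longrightarrow> z \<notin> K" by force
  then show ?thesis unfolding None by (auto simp: eventually_at_infinity)
next
  case (Some p)
  have "open (- K)" "p \<in> - K"
    using assms Some by (auto simp: compact_imp_closed)
  then show ?thesis unfolding Some
    by (auto simp: eventually_at_topological)
qed

lemma eventually_end_at_not_finite:
  assumes "finite P"
  shows "\<forall>\<^sub>F z in end_at a. z \<notin> P"
proof -
  \<comment> \<open>The point of the end \<open>a\<close> itself is split off, because the result on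
    compact sets requires it to lie outside; it is avoided since \<open>at p\<close> is a punctured
    filter.\<close>
  have "\<forall>\<^sub>F z in end_at a. z \<notin> P - set_option a"
    by (rule eventually_end_at_not_compact) (use assms in \<open>auto simp: finite_imp_compact\<close>)
  moreover have "\<forall>\<^sub>F z in end_at a. z \<notin> set_option a"
    by (cases a) (auto simp: eventually_at_filter)
  ultimately show ?thesis
    by eventually_elim auto
qed

text \<open>The outside of a disc and a punctured disc are connected because the plane has real
  dimension 2. On the real line this fails.\<close>

lemma eventually_end_at_connected:
  assumes "eventually N (end_at a)"
  shows "\<exists>A. connected A \<and> (\<forall>\<^sub>F z in end_at a. z \<in> A) \<and> (\<forall>z\<in>A. N z)"
proof (cases a)
  case None
  obtain b where b: "\<And>z. norm z \<ge> b \<Longrightarrow> N z"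
    using assms unfolding None by (auto simp: eventually_at_infinity)
  show ?thesis
  proof (intro exI conjI ballI)
    show "connected (- ball (0::complex) b)"
      by (rule connected_complement_bounded_convex) auto
    show "\<forall>\<^sub>F z in end_at a. z \<in> - ball 0 b"
      unfolding None by (auto simp: eventually_at_infinity intro!: exI[of _ b])
    show "N z" if "z \<in> - ball 0 b" for z using that b by auto
  qed
next
  case (Some p)
  obtain d where d: "d > 0" "\<And>z. z \<noteq> p \<Longrightarrow> dist z p < d \<Longrightarrow> N z"
    using assms unfolding Some by (auto simp: eventually_at)
  show ?thesis
  proof (intro exI conjI ballI)
    show "connected (ball p d - {p})"
      by (rule connected_punctured_ball) auto
    show "\<forall>\<^sub>F z in end_at a. z \<in> ball p d - {p}"
      unfolding Some using d(1) by (auto simp: eventually_at dist_commute)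
    show "N z" if "z \<in> ball p d - {p}" for z using that d by (auto simp: dist_commute)
  qed
qed

text \<open>The sets are small discs around the points of Q and the outside of a large disc. The
  last clause is the form suited to proper maps: a neighbourhood of the end b contains
  \<open>U b\<close> up to Q and a compact K off Q, so a map into the complement of Q that stays in
  \<open>U b\<close> and eventually leaves every such K tends to b.\<close>

lemma end_neighbourhoods:
  assumes "finite Q"
  shows "\<exists>U :: complex option \<Rightarrow> complex set.
    (\<forall>b\<in>ends Q. open (U b)) \<and>
    (\<forall>b\<in>ends Q. \<forall>c\<in>ends Q. b \<noteq> c \<longrightarrow> U b \<inter> U c = {}) \<and>
    compact (- (\<Union>b\<in>ends Q. U b)) \<and> Q \<subseteq> (\<Union>b\<in>ends Q. U b) \<and>
    (\<forall>b\<in>ends Q. \<forall>N. eventually N (end_at b) \<longrightarrow>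
       (\<exists>K. compact K \<and> K \<subseteq> - Q \<and> (\<forall>w\<in>U b - K - Q. N w)))"
proof -
  have "\<exists>d>0. \<forall>p\<in>Q. \<forall>q\<in>Q. p \<noteq> q \<longrightarrow> 2 * d \<le> dist p q"
  proof -
    have "\<exists>e>0. \<forall>p\<in>Q. \<forall>q\<in>Q. p \<noteq> q \<longrightarrow> e \<le> dist p q"
    proof -
      \<comment> \<open>The extra element 1 keeps the set nonempty, so that \<open>Min\<close> is
        meaningful, when Q has at most one point.\<close>
      let ?D = "insert 1 ((\<lambda>(p,q). dist p q) ` {(p,q)\<in>Q\<times>Q. p \<noteq> q})"
      have fin: "finite ?D"
        by (intro finite.insertI finite_imageI finite_subset[OF _ finite_cartesian_product[OF assms assms]]) auto
      have "Min ?D > 0" by (subst Min_gr_iff[OF fin]) auto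
      moreover have "Min ?D \<le> dist p q" if "p \<in> Q" "q \<in> Q" "p \<noteq> q" for p q
        by (rule Min_le[OF fin]) (use that in auto)
      ultimately show ?thesis by blast
    qed
    then obtain e where "e > 0" "\<forall>p\<in>Q. \<forall>q\<in>Q. p \<noteq> q \<longrightarrow> e \<le> dist p q" by blast
    then show ?thesis by (intro exI[of _ "e / 2"]) auto
  qed
  then obtain d where d: "d > 0" "\<And>p q. p \<in> Q \<Longrightarrow> q \<in> Q \<Longrightarrow> p \<noteq> q \<Longrightarrow> 2 * d \<le> dist p q"
    by blast
  have "bounded (\<Union>q\<in>Q. ball q d)" using assms by (intro bounded_UN) auto
  then obtain R0 where "\<forall>w\<in>(\<Union>q\<in>Q. ball q d). norm w \<le> R0"
    unfolding bounded_iff by blast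
  then have R0: "norm w \<le> R0" if "q \<in> Q" "dist q w < d" for q w
    using that by auto
  \<comment> \<open>The margin gives \<open>norm q < R\<close> strictly, which keeps the set
    \<open>cball 0 r - ball 0 R\<close> below off Q.\<close>
  define R where "R = R0 + 1"
  have R: "norm w < R" if "q \<in> Q" "dist q w < d" for q w
    using R0[OF that] by (simp add: R_def)
  have RQ: "norm q < R" if "q \<in> Q" for q using R[of q q] that d by simp
  define U where "U b = (case b of None \<Rightarrow> {w. norm w > R} | Some q \<Rightarrow> ball q d)" for b :: "complex option"
  have UU: "(\<Union>b\<in>ends Q. U b) = {w. norm w > R} \<union> (\<Union>q\<in>Q. ball q d)"
    by (simp add: U_def ends_def)
  have opn: "open {w::complex. norm w > R}"
    by (intro open_Collect_less continuous_intros)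
  show ?thesis
  proof (intro exI[of _ U] conjI ballI allI impI)
    show "open (U b)" for b
      using opn by (cases b) (auto simp: U_def)
    show "U b \<inter> U c = {}" if "b \<in> ends Q" "c \<in> ends Q" "b \<noteq> c" for b c
    proof (cases b; cases c)
      fix p q assume bc: "b = Some p" "c = Some q"
      then have "2 * d \<le> dist p q" using that d(2)[of p q] by (auto simp: ends_def)
      then show ?thesis unfolding bc by (auto simp: U_def intro!: disjoint_ballI)
    qed (use that R in \<open>force simp: U_def ends_def\<close>)+
    have "- (\<Union>b\<in>ends Q. U b) = cball 0 R - (\<Union>q\<in>Q. ball q d)"
      unfolding UU by auto
    then show "compact (- (\<Union>b\<in>ends Q. U b))"
      by (simp add: compact_diff open_UN)
    show "Q \<subseteq> (\<Union>b\<in>ends Q. U b)" unfolding UU using d(1) by auto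
    show "\<exists>K. compact K \<and> K \<subseteq> - Q \<and> (\<forall>w\<in>U b - K - Q. N w)"
      if b: "b \<in> ends Q" and N: "eventually N (end_at b)" for b N
    proof (cases b)
      case None
      obtain r where r: "\<And>z. norm z \<ge> r \<Longrightarrow> N z"
        using N unfolding None by (auto simp: eventually_at_infinity)
      show ?thesis
      proof (intro exI conjI)
        show "compact (cball 0 r - ball (0::complex) R)" by (simp add: compact_diff)
        show "cball 0 r - ball (0::complex) R \<subseteq> - Q" using RQ by force
        show "\<forall>w\<in>U b - (cball 0 r - ball (0::complex) R) - Q. N w"
          using r by (force simp: U_def None)
      qed
    next
      case (Some q)
      obtain e where e: "e > 0" "\<And>z. z \<noteq> q \<Longrightarrow> dist z q < e \<Longrightarrow> N z"
        using N unfolding Some by (auto simp: eventually_at)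
      have q: "q \<in> Q" using b Some by (auto simp: ends_def)
      show ?thesis
      proof (intro exI conjI)
        show "compact (cball q d - ball q e)" by (simp add: compact_diff)
        \<comment> \<open>Every other puncture is at distance at least \<open>2 * d\<close> from q,
          hence outside \<open>cball q d\<close>.\<close>
        show "cball q d - ball q e \<subseteq> - Q"
          using d q e by (force simp: subset_iff)
        show "\<forall>w\<in>U b - (cball q d - ball q e) - Q. N w"
        proof
          fix w assume w: "w \<in> U b - (cball q d - ball q e) - Q"
          then have "w \<noteq> q" using q by blast
          then show "N w" using w by (intro e(2)) (auto simp: U_def Some dist_commute)
        qed
      qed
    qed
  qed
qed

text \<open>
  A homeomorphism of punctured planes is proper, so near an end it leaves every compact set;
  since a punctured neighbourhood of an end is connected, its image tends to a single end.
\<close>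

lemma homeomorphism_end_limit:
  assumes "finite P" "finite Q" and hom: "homeomorphism (- P) (- Q) f f'" and a: "a \<in> ends P"
  shows "\<exists>b\<in>ends Q. filterlim f (end_at b) (end_at a)"
proof -
  have off_P: "\<forall>\<^sub>F z in end_at a. z \<notin> P"
    using \<open>finite P\<close> by (rule eventually_end_at_not_finite)
  have f_off_Q: "f z \<notin> Q" if "z \<notin> P" for z
    using homeomorphism_image1[OF hom] that by auto
  have avoid: "\<forall>\<^sub>F z in end_at a. f z \<notin> K" if K: "compact K" "K \<subseteq> - Q" for K
  proof -
    have "f' ` K \<subseteq> - P"
      using homeomorphism_image2[OF hom] K(2) by blast
    moreover have "compact (f' ` K)"
      using hom K by (intro compact_continuous_image)
        (auto simp: homeomorphism_def intro: continuous_on_subset)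
    ultimately have "\<forall>\<^sub>F z in end_at a. z \<notin> f' ` K"
      using a by (intro eventually_end_at_not_compact) (auto simp: ends_def)
    with off_P show ?thesis
    proof eventually_elim
      case (elim z)
      then show ?case using homeomorphism_apply1[OF hom, of z] by force
    qed
  qed
  obtain U :: "complex option \<Rightarrow> complex set" where U:
    "\<forall>b\<in>ends Q. open (U b)"
    "\<forall>b\<in>ends Q. \<forall>c\<in>ends Q. b \<noteq> c \<longrightarrow> U b \<inter> U c = {}"
    "compact (- (\<Union>b\<in>ends Q. U b))" "Q \<subseteq> (\<Union>b\<in>ends Q. U b)"
    "\<forall>b\<in>ends Q. \<forall>N. eventually N (end_at b) \<longrightarrow>
       (\<exists>K. compact K \<and> K \<subseteq> - Q \<and> (\<forall>w\<in>U b - K - Q. N w))"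
    using end_neighbourhoods[OF \<open>finite Q\<close>] by (elim exE conjE)
  have "\<forall>\<^sub>F z in end_at a. f z \<notin> - (\<Union>b\<in>ends Q. U b)"
    using U(4) by (intro avoid U(3)) (simp only: Compl_subset_Compl_iff)
  with off_P have ev: "\<forall>\<^sub>F z in end_at a. z \<notin> P \<and> f z \<in> (\<Union>b\<in>ends Q. U b)"
    by eventually_elim auto
  obtain A where A: "connected A" "\<forall>\<^sub>F z in end_at a. z \<in> A"
      "\<forall>z\<in>A. z \<notin> P \<and> f z \<in> (\<Union>b\<in>ends Q. U b)"
    using eventually_end_at_connected[OF ev] by (elim exE conjE)
  have "A \<noteq> {}"
    using A(2) end_at_ne_bot[of a] by (auto simp: trivial_limit_def)
  then obtain z0 b where z0: "z0 \<in> A" and b: "b \<in> ends Q" "f z0 \<in> U b"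
    using A(3) by blast
  \<comment> \<open>The image meets \<open>U b\<close> and is covered by \<open>U b\<close> and the
    union of the other neighbourhoods, two disjoint open sets; so it stays in
    \<open>U b\<close>.\<close>
  have "connected (f ` A)"
    using hom A(1,3) by (intro connected_continuous_image)
      (auto simp: homeomorphism_def intro: continuous_on_subset)
  moreover have "open (\<Union>c\<in>ends Q - {b}. U c)"
    using U(1) by auto
  moreover have "f ` A \<subseteq> U b \<union> (\<Union>c\<in>ends Q - {b}. U c)"
    using A(3) by blast
  moreover have "U b \<inter> (\<Union>c\<in>ends Q - {b}. U c) = {}"
    using U(2) b(1) by blast
  ultimately have "(\<Union>c\<in>ends Q - {b}. U c) \<inter> f ` A = {}"
    using connectedD[of "f ` A" "U b" "\<Union>c\<in>ends Q - {b}. U c"] U(1) b z0 by blast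
  then have fA: "f z \<in> U b" if "z \<in> A" for z
    using A(3) that by blast
  have "filterlim f (end_at b) (end_at a)"
    unfolding filterlim_iff
  proof (intro allI impI)
    fix N assume "eventually N (end_at b)"
    then obtain K where K: "compact K" "K \<subseteq> - Q" "\<forall>w\<in>U b - K - Q. N w"
      using U(5) b(1) by blast
    show "\<forall>\<^sub>F z in end_at a. N (f z)"
      using avoid[OF K(1,2)] A(2)
    proof eventually_elim
      case (elim z)
      then show ?case using K(3) fA f_off_Q A(3) by blast
    qed
  qed
  with b(1) show ?thesis by blast
qed

text \<open>Sending each end a to an end \<open>e a\<close> to which f tends is injective: along
  \<open>end_at (e a)\<close> the inverse tends to some end d, and as f followed by f' is the
  identity, d = a. So \<open>e a\<close> determines a. The end at infinity is counted on both sides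
  and cancels.\<close>

lemma homeomorphism_punctured_planes_card_le:
  fixes P Q :: "complex set"
  assumes "finite P" "finite Q" "homeomorphism (- P) (- Q) f f'"
  shows "card P \<le> card Q"
proof -
  have hom': "homeomorphism (- Q) (- P) f' f"
    using assms(3) by (rule homeomorphism_symD)
  have "\<forall>a\<in>ends P. \<exists>b\<in>ends Q. filterlim f (end_at b) (end_at a)"
    using homeomorphism_end_limit[OF assms] by blast
  then obtain e where e: "\<And>a. a \<in> ends P \<Longrightarrow> e a \<in> ends Q"
      "\<And>a. a \<in> ends P \<Longrightarrow> filterlim f (end_at (e a)) (end_at a)"
    by metis
  have recover: "d = a"
    if "a \<in> ends P" "filterlim f' (end_at d) (end_at (e a))" for a d
  proof -
    have "filterlim (\<lambda>z. f' (f z)) (end_at d) (end_at a)"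
      using filterlim_compose[OF that(2) e(2)[OF that(1)]] .
    moreover have "\<forall>\<^sub>F z in end_at a. f' (f z) = z"
      using eventually_end_at_not_finite[OF assms(1)]
      by eventually_elim (use homeomorphism_apply1[OF assms(3)] in auto)
    ultimately have "filterlim (\<lambda>z. z) (end_at d) (end_at a)"
      by (simp cong: filterlim_cong)
    then show ?thesis
      using end_at_le_imp_eq by (auto simp: filterlim_def)
  qed
  have "inj_on e (ends P)"
  proof (rule inj_onI)
    fix a a' assume "a \<in> ends P" "a' \<in> ends P" "e a = e a'"
    moreover obtain d where "filterlim f' (end_at d) (end_at (e a))"
      using homeomorphism_end_limit[OF assms(2,1) hom' e(1)] \<open>a \<in> ends P\<close> by blast
    ultimately show "a = a'" using recover by metis
  qed
  then have "card (ends P) \<le> card (ends Q)"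
    using e(1) finite_ends[OF assms(2)] by (intro card_inj_on_le) auto
  then show ?thesis using assms by (simp add: card_ends)
qed

lemma homeomorphic_punctured_planes_card_eq:
  fixes P Q :: "complex set"
  assumes "finite P" "finite Q" "(- P) homeomorphic (- Q)"
  shows "card P = card Q"
proof -
  obtain f f' where hom: "homeomorphism (- P) (- Q) f f'"
    using assms(3) unfolding homeomorphic_def by blast
  then have hom': "homeomorphism (- Q) (- P) f' f"
    by (rule homeomorphism_symD)
  show ?thesis
    using homeomorphism_punctured_planes_card_le[OF assms(1,2) hom]
      homeomorphism_punctured_planes_card_le[OF assms(2,1) hom'] by simp
qed

section \<open>Affine functions\<close>

lemma cspace_translate [simp]:
  "x \<in> cspace k \<Longrightarrow> v \<in> cspace k \<Longrightarrow> w \<in> cspace k \<Longrightarrow> x + cscale s (w - v) \<in> cspace k"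
  by (simp add: cspace_def cscale_def)

lemma trunc_in_cspace [simp]: "trunc k x \<in> cspace k"
  by (simp add: trunc_def cspace_def)

lemma trunc_cspace: "x \<in> cspace k \<Longrightarrow> trunc k x = x"
  by (auto simp: trunc_def cspace_def)

lemma zero_in_cspace [simp]: "0 \<in> cspace k"
  by (simp add: cspace_def)

text \<open>Together with the converse \<open>affine_functionI\<close>, this describes affine
  functions without coefficients; differences, compositions and inverses are then handled by
  rewriting.\<close>

lemma affine_function_translate:
  assumes "affine_function k f" "x \<in> cspace k" "v \<in> cspace k" "w \<in> cspace k"
  shows "f (x + cscale s (w - v)) = f x + s * (f w - f v)"
proof -
  obtain a b where ab: "\<forall>x\<in>cspace k. f x = (\<Sum>i<k. a i * x i) + b"
    using assms(1) by (auto simp: affine_function_def)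
  have "(\<Sum>i<k. a i * (x i + s * (w i - v i))) =
      (\<Sum>i<k. a i * x i) + s * ((\<Sum>i<k. a i * w i) - (\<Sum>i<k. a i * v i))"
    by (simp add: algebra_simps sum.distrib sum_subtractf sum_distrib_left)
  then show ?thesis
    using assms ab[rule_format, OF cspace_translate[OF assms(2-4), of s]] ab
    by (simp add: cscale_def)
qed

text \<open>The coordinates of x are switched on one at a time. Switching on the j-th one moves from
  \<open>trunc j x\<close> in the direction from 0 to the unit vector \<open>e j\<close>, which
  changes f by \<open>x j * (f (e j) - f 0)\<close>; this yields the coefficients.\<close>

lemma affine_functionI:
  assumes "\<And>x v w s. x \<in> cspace k \<Longrightarrow> v \<in> cspace k \<Longrightarrow> w \<in> cspace k \<Longrightarrow>
    f (x + cscale s (w - v)) = f x + s * (f w - f v)"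
  shows "affine_function k f"
proof -
  define e where "e i = (\<lambda>j. if j = i then 1 else 0 :: complex)" for i :: nat
  define c where "c = f 0"
  have "f (trunc j x) = (\<Sum>i<j. (f (e i) - c) * x i) + c" if "j \<le> k" for j x
    using that
  proof (induction j)
    case 0
    have "f (trunc 0 x) = f 0" by (rule arg_cong[of _ _ f]) (auto simp: trunc_def)
    then show ?case unfolding c_def by simp
  next
    case (Suc j)
    have "trunc (Suc j) x = trunc j x + cscale (x j) (e j - 0)"
      by (auto simp: trunc_def cscale_def e_def fun_eq_iff less_Suc_eq)
    then have "f (trunc (Suc j) x) = f (trunc j x + cscale (x j) (e j - 0))" by simp
    also have "\<dots> = f (trunc j x) + x j * (f (e j) - c)"
      unfolding c_def using Suc.prems by (intro assms) (auto simp: trunc_def cspace_def e_def)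
    finally show ?case using Suc by (simp add: algebra_simps)
  qed
  then show ?thesis
    unfolding affine_function_def
    by (intro exI[of _ "\<lambda>i. f (e i) - c"] exI[of _ c]) (metis trunc_cspace order_refl)
qed

lemma affine_function_diff:
  assumes "affine_function k f" "affine_function k h"
  shows "affine_function k (\<lambda>x. f x - h x)"
  by (rule affine_functionI, simp only: affine_function_translate[OF assms(1)]
      affine_function_translate[OF assms(2)], simp add: algebra_simps)

lemma continuous_on_affine_function:
  assumes "affine_function k f"
  shows "continuous_on (cspace k) f"
proof -
  obtain a b where ab: "\<forall>x\<in>cspace k. f x = (\<Sum>i<k. a i * x i) + b"
    using assms by (auto simp: affine_function_def)
  have "continuous_on (cspace k) (\<lambda>x. (\<Sum>i<k. a i * x i) + b)"
    by (intro continuous_intros continuous_on_subset[OF continuous_on_product_coordinates]) auto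
  then show ?thesis using ab by (simp cong: continuous_on_cong)
qed

text \<open>On a generic line through two points no nonzero affine function vanishes identically.\<close>

lemma affine_functions_common_nonzero:
  assumes "finite I" and aff: "\<And>i. i \<in> I \<Longrightarrow> affine_function k (f i)"
    and L: "L \<subseteq> cspace k" "L \<noteq> {}" "\<And>p q s. p \<in> L \<Longrightarrow> q \<in> L \<Longrightarrow> p + cscale s (q - p) \<in> L"
    and nz: "\<And>i. i \<in> I \<Longrightarrow> \<exists>p\<in>L. f i p \<noteq> 0"
  shows "\<exists>p\<in>L. \<forall>i\<in>I. f i p \<noteq> 0"
  using assms(1) aff nz
proof (induction I rule: finite_induct)
  case empty
  then show ?case using L(2) by auto
next
  case (insert j I)
  have "\<exists>p\<in>L. \<forall>i\<in>I. f i p \<noteq> 0" using insert.prems by (intro insert.IH) auto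
  then obtain p where p: "p \<in> L" "\<forall>i\<in>I. f i p \<noteq> 0" by blast
  obtain q where q: "q \<in> L" "f j q \<noteq> 0" using insert.prems(2)[of j] by blast
  have line: "f i (p + cscale s (q - p)) = f i p + s * (f i q - f i p)" if "i \<in> insert j I" for i s
    using insert.prems(1)[OF that] p q L(1) by (intro affine_function_translate) auto
  \<comment> \<open>On the line each \<open>f i\<close> is affine in s and not identically zero,
    being nonzero at p, or at q for the new index j. So it has at most one root, listed here; if
    \<open>f i p = f i q\<close>, division by zero merely adds a harmless 0.\<close>
  let ?bad = "insert (f j p / (f j p - f j q)) ((\<lambda>i. f i p / (f i p - f i q)) ` I)"
  have "finite ?bad" using insert by auto
  then obtain s where s: "s \<notin> ?bad" using ex_new_if_finite[OF infinite_UNIV_char_0] by blast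
  have "f i p + s * (f i q - f i p) \<noteq> 0" if "i \<in> insert j I" for i
  proof
    assume 0: "f i p + s * (f i q - f i p) = 0"
    have ne: "f i p \<noteq> 0 \<or> f i q \<noteq> 0" using that p q by auto
    have "f i p - f i q \<noteq> 0"
    proof
      assume "f i p - f i q = 0"
      then show False using 0 ne by auto
    qed
    moreover have "s * (f i p - f i q) = f i p" using 0 by (simp add: algebra_simps)
    ultimately have "s = f i p / (f i p - f i q)" by (simp add: eq_divide_eq)
    then show False using s that by auto
  qed
  then have "\<forall>i\<in>insert j I. f i (p + cscale s (q - p)) \<noteq> 0"
    unfolding Ball_def using line by metis
  then show ?case
    using L(3)[OF p(1) q(1)] by blast
qed

text \<open>If \<open>{\<alpha> = 0} \<subseteq> {\<beta> = 0}\<close>, then \<open>\<beta>\<close> is a multiple of \<open>\<alpha>\<close>.\<close>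

lemma affine_zero_set_subset_imp_eq:
  assumes aff: "affine_function k \<alpha>" "affine_function k \<beta>"
    and sub: "\<And>x. x \<in> cspace k \<Longrightarrow> \<alpha> x = 0 \<Longrightarrow> \<beta> x = 0"
    and v: "v \<in> cspace k" "\<alpha> v = 0" and w: "w \<in> cspace k" "\<alpha> w \<noteq> 0"
    and u: "u \<in> cspace k" "\<beta> u \<noteq> 0"
  shows "{x \<in> cspace k. \<alpha> x = 0} = {x \<in> cspace k. \<beta> x = 0}"
proof -
  have mult: "\<beta> x = \<alpha> x / \<alpha> w * \<beta> w" if x: "x \<in> cspace k" for x
  proof -
    \<comment> \<open>Since \<alpha> v = 0, moving along v - w by this factor lowers \<alpha> by
      exactly \<alpha> x and lands in the zero set of \<alpha>.\<close>
    have "\<beta> (x + cscale (\<alpha> x / \<alpha> w) (v - w)) = 0"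
      using x v w by (intro sub) (simp_all add: affine_function_translate[OF aff(1)])
    moreover have "\<beta> v = 0" using sub v by blast
    ultimately show ?thesis
      using affine_function_translate[OF aff(2) x w(1) v(1)] by simp
  qed
  moreover have "\<beta> w \<noteq> 0" using mult[OF u(1)] u(2) by auto
  ultimately show ?thesis using w(2) by auto
qed

section \<open>Affine coordinates\<close>

lemma trunc_translate:
  "trunc k (x + cscale s (w - v)) = trunc k x + cscale s (trunc k w - trunc k v)"
  by (auto simp: trunc_def cscale_def fun_eq_iff)

lemma trunc_fun_upd: "x \<in> cspace k \<Longrightarrow> trunc k (x(k := z)) = x"
  by (auto simp: trunc_def cspace_def fun_eq_iff)

lemma fun_upd_in_cspace: "x \<in> cspace k \<Longrightarrow> x(k := z) \<in> cspace (Suc k)"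
  by (auto simp: cspace_def)

lemma trunc_fun_upd_last: "y \<in> cspace (Suc k) \<Longrightarrow> (trunc k y)(k := y k) = y"
  by (auto simp: trunc_def cspace_def fun_eq_iff)

lemma affine_coordinates_in_cspace:
  "affine_coordinates k T \<Longrightarrow> v \<in> cspace k \<Longrightarrow> T v \<in> cspace k"
  by (auto simp: affine_coordinates_def bij_betw_def)

lemma affine_coordinates_translate:
  assumes T: "affine_coordinates k T" and "x \<in> cspace k" "v \<in> cspace k" "w \<in> cspace k"
  shows "T (x + cscale s (w - v)) = T x + cscale s (T w - T v)"
proof
  fix i
  show "T (x + cscale s (w - v)) i = (T x + cscale s (T w - T v)) i"
  proof (cases "i < k")
    case True
    then have "affine_function k (\<lambda>v. T v i)" using T by (simp add: affine_coordinates_def)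
    from affine_function_translate[OF this assms(2-4), of s] show ?thesis
      by (simp only: plus_fun_apply) (simp add: cscale_def)
  next
    case False
    have "y i = 0" if "y \<in> cspace k" for y using that False by (simp add: cspace_def)
    moreover have "T (x + cscale s (w - v)) \<in> cspace k" "T x + cscale s (T w - T v) \<in> cspace k"
      using assms affine_coordinates_in_cspace[OF T] by simp_all
    ultimately show ?thesis by metis
  qed
qed

text \<open>The inverse respects the combinations x + s(w - v) because T does and is injective;
  \<open>affine_functionI\<close> then makes its coordinates affine without inverting a
  matrix.\<close>

lemma affine_coordinates_inv_into:
  assumes T: "affine_coordinates k T"
  shows "affine_coordinates k (inv_into (cspace k) T)" (is "affine_coordinates k ?T'")
proof -
  have bij: "bij_betw T (cspace k) (cspace k)" using T by (simp add: affine_coordinates_def)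
  have T': "?T' y \<in> cspace k" "T (?T' y) = y" if "y \<in> cspace k" for y
    using bij that by (auto simp: bij_betw_inv_into_right intro: bij_betw_apply[OF bij_betw_inv_into])
  have "?T' (x + cscale s (w - v)) = ?T' x + cscale s (?T' w - ?T' v)"
    if "x \<in> cspace k" "v \<in> cspace k" "w \<in> cspace k" for x v w s
  proof -
    have "T (?T' x + cscale s (?T' w - ?T' v)) = x + cscale s (w - v)"
      using affine_coordinates_translate[OF T T'(1)[OF that(1)] T'(1)[OF that(2)] T'(1)[OF that(3)], of s]
      by (simp only: T'(2) that)
    moreover have "?T' x + cscale s (?T' w - ?T' v) \<in> cspace k"
      using T'(1) that by (intro cspace_translate)
    ultimately show ?thesis
      using bij_betw_inv_into_left[OF bij] by metis
  qed
  then have "affine_function k (\<lambda>v. ?T' v i)" for i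
    by (intro affine_functionI) (simp only: plus_fun_apply, simp add: cscale_def)
  then show ?thesis using bij by (simp add: affine_coordinates_def bij_betw_inv_into)
qed

lemma continuous_on_affine_coordinates:
  assumes T: "affine_coordinates k T"
  shows "continuous_on (cspace k) T"
proof (rule continuous_on_coordinatewise_then_product)
  fix i
  show "continuous_on (cspace k) (\<lambda>v. T v i)"
  proof (cases "i < k")
    case True
    then show ?thesis
      using T by (intro continuous_on_affine_function) (simp add: affine_coordinates_def)
  next
    case False
    then have "T v i = 0" if "v \<in> cspace k" for v
      using affine_coordinates_in_cspace[OF T that] by (simp add: cspace_def)
    then have "continuous_on (cspace k) (\<lambda>v. T v i) \<longleftrightarrow> continuous_on (cspace k) (\<lambda>v. 0 :: complex)"
      by (intro continuous_on_cong) auto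
    then show ?thesis by simp
  qed
qed

lemma continuous_on_trunc:
  assumes "continuous_on S f"
  shows "continuous_on S (\<lambda>x. trunc k (f x))"
proof (rule continuous_on_coordinatewise_then_product)
  show "continuous_on S (\<lambda>x. trunc k (f x) i)" for i
    using assms by (cases "i < k") (auto simp: trunc_def dest: continuous_on_product_then_coordinatewise)
qed

lemma continuous_on_fun_upd:
  fixes f :: "'a::topological_space \<Rightarrow> 'i \<Rightarrow> 'b::topological_space"
  assumes "continuous_on S f" "continuous_on S h"
  shows "continuous_on S (\<lambda>x. (f x)(i := h x))"
proof (rule continuous_on_coordinatewise_then_product)
  show "continuous_on S (\<lambda>x. ((f x)(i := h x)) j)" for j
    using assms by (cases "j = i") (auto dest: continuous_on_product_then_coordinatewise)
qed

lemma affine_function_compose_trunc: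
  assumes T: "affine_coordinates (Suc l) T" and \<beta>: "affine_function l \<beta>"
  shows "affine_function (Suc l) (\<lambda>v. \<beta> (trunc l (T v)))"
  by (rule affine_functionI)
    (simp only: affine_coordinates_translate[OF T] trunc_translate
      affine_function_translate[OF \<beta> trunc_in_cspace trunc_in_cspace trunc_in_cspace])

section \<open>Arrangements and their root maps\<close>

text \<open>Each H lies in the zero set of Q, which the zero sets of the functions in I cover. An
  affine space over an infinite field is not a finite union of proper affine subspaces, so a single
  \<phi> vanishes on all of H. As \<phi> w is nonzero, H is the whole zero set of \<phi>. This
  bounds the number of hyperplanes by the number of factors.\<close>

lemma arrangement_subset_zero_sets:
  assumes arr: "arrangement k \<A>" and Q: "defining_polynomial k \<A> Q"
    and I: "finite I" "\<And>\<phi>. \<phi> \<in> I \<Longrightarrow> affine_function k \<phi>"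
    and zero: "\<And>v. v \<in> cspace k \<Longrightarrow> Q v = 0 \<longleftrightarrow> (\<exists>\<phi>\<in>I. \<phi> v = 0)"
    and w: "w \<in> arr_complement k \<A>"
  shows "\<A> \<subseteq> (\<lambda>\<phi>. {v \<in> cspace k. \<phi> v = 0}) ` I"
proof
  fix H assume H: "H \<in> \<A>"
  obtain \<alpha> where \<alpha>: "\<And>H. H \<in> \<A> \<Longrightarrow> affine_function k (\<alpha> H)"
      "\<And>H. H \<in> \<A> \<Longrightarrow> H = {x \<in> cspace k. \<alpha> H x = 0}"
      "\<And>x. x \<in> cspace k \<Longrightarrow> Q x = (\<Prod>H\<in>\<A>. \<alpha> H x)"
    using Q unfolding defining_polynomial_def by metis
  have fin: "finite \<A>" using arr by (simp add: arrangement_def)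
  have "hyperplane k H" using arr H by (simp add: arrangement_def)
  then obtain v W where "cvec.subspace W" "H = (+) v ` W"
    by (auto simp: hyperplane_def)
  \<comment> \<open>Nonemptiness of H comes from \<open>hyperplane\<close>; the zero set of an
    affine function alone could be empty.\<close>
  then have vH: "v + 0 \<in> H" using cvec.subspace_0 by blast
  have w': "w \<in> cspace k" "Q w \<noteq> 0" "\<alpha> H w \<noteq> 0"
  proof -
    show wk: "w \<in> cspace k" using w by (simp add: arr_complement_def)
    have "\<alpha> H' w \<noteq> 0" if "H' \<in> \<A>" for H'
    proof
      assume "\<alpha> H' w = 0"
      then have "w \<in> H'" using \<alpha>(2)[OF that] wk by blast
      then show False using w that by (auto simp: arr_complement_def)
    qed
    then show "Q w \<noteq> 0" "\<alpha> H w \<noteq> 0" using H \<alpha>(3)[OF wk] fin by simp_all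
  qed
  have "\<exists>\<phi>\<in>I. \<forall>x\<in>H. \<phi> x = 0"
  proof (rule ccontr)
    assume neg: "\<not> ?thesis"
    have "\<exists>p\<in>H. \<forall>\<phi>\<in>I. \<phi> p \<noteq> 0"
    proof (rule affine_functions_common_nonzero[where k = k])
      show "p + cscale s (q - p) \<in> H" if "p \<in> H" "q \<in> H" for p q s
      proof -
        have pq: "p \<in> cspace k" "q \<in> cspace k" "\<alpha> H p = 0" "\<alpha> H q = 0"
          using that \<alpha>(2)[OF H] by blast+
        have "p + cscale s (q - p) \<in> {x \<in> cspace k. \<alpha> H x = 0}"
          using pq affine_function_translate[OF \<alpha>(1)[OF H] pq(1) pq(1) pq(2), of s]
            cspace_translate[OF pq(1) pq(1) pq(2), of s] by simp
        then show ?thesis using \<alpha>(2)[OF H] by blast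
      qed
    qed (use I neg vH \<alpha>(2)[OF H] in blast)+
    then obtain p where p: "p \<in> H" "\<forall>\<phi>\<in>I. \<phi> p \<noteq> 0" by blast
    then have pk: "p \<in> cspace k" "\<alpha> H p = 0" using \<alpha>(2)[OF H] by blast+
    then have "Q p = 0" using \<alpha>(3) H fin by auto
    then show False using zero[OF pk(1)] p(2) by blast
  qed
  then obtain \<phi> where \<phi>: "\<phi> \<in> I" "\<And>x. x \<in> H \<Longrightarrow> \<phi> x = 0" by blast
  have "{x \<in> cspace k. \<alpha> H x = 0} = {x \<in> cspace k. \<phi> x = 0}"
  proof (rule affine_zero_set_subset_imp_eq)
    show "\<phi> x = 0" if "x \<in> cspace k" "\<alpha> H x = 0" for x
      using \<phi>(2) \<alpha>(2)[OF H] that by blast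
    show "v + 0 \<in> cspace k" "\<alpha> H (v + 0) = 0" using vH \<alpha>(2)[OF H] by blast+
    show "\<phi> w \<noteq> 0" using zero[OF w'(1)] w'(2) \<phi>(1) by blast
  qed (use w' \<alpha>(1) H I(2) \<phi>(1) in auto)
  then show "H \<in> (\<lambda>\<phi>. {v \<in> cspace k. \<phi> v = 0}) ` I"
    using \<alpha>(2)[OF H] \<phi>(1) by blast
qed

lemma defining_polynomial_nonzero_iff:
  assumes "defining_polynomial k \<A> Q" "finite \<A>" "x \<in> cspace k"
  shows "Q x \<noteq> 0 \<longleftrightarrow> x \<in> arr_complement k \<A>"
proof -
  obtain \<alpha> where \<alpha>: "\<And>H. H \<in> \<A> \<Longrightarrow> H = {x \<in> cspace k. \<alpha> H x = 0}"
      "\<And>x. x \<in> cspace k \<Longrightarrow> Q x = (\<Prod>H\<in>\<A>. \<alpha> H x)"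
    using assms(1) unfolding defining_polynomial_def by metis
  have "\<alpha> H x = 0 \<longleftrightarrow> x \<in> H" if "H \<in> \<A>" for H
    using \<alpha>(1)[OF that] assms(3) by blast
  then show ?thesis
    using \<alpha>(2)[OF assms(3)] assms(2,3) by (auto simp: arr_complement_def)
qed

lemma root_map_arr_complement_iff:
  assumes "root_map l n T \<A> \<B> g" "finite \<A>" "finite \<B>" "v \<in> cspace (Suc l)"
  shows "v \<in> arr_complement (Suc l) \<A> \<longleftrightarrow>
    trunc l (T v) \<in> arr_complement l \<B> \<and> T v l \<notin> g (trunc l (T v)) ` {..<n}"
proof -
  obtain QA QB where Q: "defining_polynomial (Suc l) \<A> QA" "defining_polynomial l \<B> QB"
      "QA v = QB (trunc l (T v)) * (\<Prod>j<n. T v l - g (trunc l (T v)) j)"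
    using assms(1,4) unfolding root_map_def by metis
  have "v \<in> arr_complement (Suc l) \<A> \<longleftrightarrow> QA v \<noteq> 0"
    using defining_polynomial_nonzero_iff[OF Q(1) assms(2,4)] by simp
  also have "\<dots> \<longleftrightarrow> QB (trunc l (T v)) \<noteq> 0 \<and> T v l \<notin> g (trunc l (T v)) ` {..<n}"
    unfolding Q(3) by auto
  finally show ?thesis
    using defining_polynomial_nonzero_iff[OF Q(2) assms(3) trunc_in_cspace] by simp
qed

text \<open>If two root functions agreed everywhere, their factors would coincide, leaving at most
  \<open>card \<B> + n - 1\<close> zero sets for the \<open>card \<B> + n\<close> hyperplanes of
  \<A>.\<close>

lemma root_functions_distinct:
  assumes T: "affine_coordinates (Suc l) T" and g: "root_map l n T \<A> \<B> g"
    and arr: "arrangement l \<B>" "arrangement (Suc l) \<A>" and card: "card \<A> = card \<B> + n"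
    and w: "w \<in> arr_complement (Suc l) \<A>" and ij: "i < n" "j < n" "i \<noteq> j"
  shows "\<exists>x\<in>cspace l. g x i \<noteq> g x j"
proof (rule ccontr)
  assume eq: "\<not> ?thesis"
  have fin: "finite \<A>" "finite \<B>" using arr by (auto simp: arrangement_def)
  obtain QA QB where Q: "defining_polynomial (Suc l) \<A> QA" "defining_polynomial l \<B> QB"
      "\<And>v. v \<in> cspace (Suc l) \<Longrightarrow> QA v = QB (trunc l (T v)) * (\<Prod>j<n. T v l - g (trunc l (T v)) j)"
    using g unfolding root_map_def by metis
  obtain \<beta> where \<beta>: "\<And>H. H \<in> \<B> \<Longrightarrow> affine_function l (\<beta> H)"
      "\<And>x. x \<in> cspace l \<Longrightarrow> QB x = (\<Prod>H\<in>\<B>. \<beta> H x)"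
    using Q(2) unfolding defining_polynomial_def by metis
  define \<phi> where "\<phi> H v = \<beta> H (trunc l (T v))" for H v
  define \<psi> where "\<psi> j v = T v l - g (trunc l (T v)) j" for j v
  \<comment> \<open>This is an equality of total functions: \<open>trunc\<close> always lands in
    \<open>cspace l\<close>.\<close>
  have "\<psi> i = \<psi> j" using eq by (auto simp: \<psi>_def fun_eq_iff)
  then have img: "\<psi> ` {..<n} = \<psi> ` ({..<n} - {i})" using ij by auto
  let ?I = "\<phi> ` \<B> \<union> \<psi> ` {..<n}"
  have "\<A> \<subseteq> (\<lambda>\<phi>. {v \<in> cspace (Suc l). \<phi> v = 0}) ` ?I"
  proof (rule arrangement_subset_zero_sets[OF arr(2) Q(1) _ _ _ w])
    show "finite ?I" using fin by simp
    show "affine_function (Suc l) f" if "f \<in> ?I" for f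
      using that
    proof
      assume "f \<in> \<phi> ` \<B>"
      then show ?thesis
        using affine_function_compose_trunc[OF T \<beta>(1)] by (auto simp: \<phi>_def[abs_def])
    next
      assume "f \<in> \<psi> ` {..<n}"
      moreover have "affine_function (Suc l) (\<lambda>v. T v l)"
        using T by (simp add: affine_coordinates_def)
      moreover have "affine_function (Suc l) (\<lambda>v. g (trunc l (T v)) j)" if "j < n" for j
        using affine_function_compose_trunc[OF T, of "\<lambda>x. g x j"] g that by (simp add: root_map_def)
      ultimately show ?thesis
        by (auto simp: \<psi>_def[abs_def] intro!: affine_function_diff)
    qed
    show "QA v = 0 \<longleftrightarrow> (\<exists>f\<in>?I. f v = 0)" if "v \<in> cspace (Suc l)" for v
      using fin(2) by (auto simp: Q(3)[OF that] \<beta>(2) \<phi>_def \<psi>_def bex_Un)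
  qed
  then have "card \<A> \<le> card ?I"
    using fin by (meson finite_imageI finite_UnI finite_lessThan surj_card_le)
  also have "\<dots> \<le> card (\<phi> ` \<B>) + card (\<psi> ` {..<n})" by (rule card_Un_le)
  also have "\<dots> \<le> card \<B> + card ({..<n} - {i})"
    unfolding img using fin by (intro add_mono card_image_le) auto
  also have "\<dots> < card \<B> + n" using ij by simp
  finally show False using card by simp
qed

text \<open>A common nonzero is taken of the forms \<beta> H and the differences of root functions.
  None of them vanishes identically: the forms are nonzero at the base point under w, and the
  differences are covered by \<open>root_functions_distinct\<close>.\<close>

lemma exists_generic_distinct_roots:
  assumes T: "affine_coordinates (Suc l) T" and g: "root_map l n T \<A> \<B> g"
    and arr: "arrangement l \<B>" "arrangement (Suc l) \<A>" and card: "card \<A> = card \<B> + n"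
    and w: "w \<in> arr_complement (Suc l) \<A>"
  shows "\<exists>x\<in>arr_complement l \<B>. inj_on (g x) {..<n}"
proof -
  have fin: "finite \<A>" "finite \<B>" using arr by (auto simp: arrangement_def)
  have "w \<in> cspace (Suc l)" using w by (simp add: arr_complement_def)
  then have x0: "trunc l (T w) \<in> arr_complement l \<B>"
    using root_map_arr_complement_iff[OF g fin] w by blast
  obtain QB where Q: "defining_polynomial l \<B> QB"
    using g unfolding root_map_def by metis
  obtain \<beta> where \<beta>: "\<And>H. H \<in> \<B> \<Longrightarrow> affine_function l (\<beta> H)"
      "\<And>H. H \<in> \<B> \<Longrightarrow> H = {x \<in> cspace l. \<beta> H x = 0}"
    using Q unfolding defining_polynomial_def by metis
  let ?D = "{(i, j) \<in> {..<n} \<times> {..<n}. i \<noteq> j}"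
  let ?I = "\<beta> ` \<B> \<union> (\<lambda>(i, j) x. g x i - g x j) ` ?D"
  have "\<exists>x\<in>cspace l. \<forall>f\<in>?I. f x \<noteq> 0"
  proof (rule affine_functions_common_nonzero[where k = l])
    have "finite ?D" by (rule finite_subset[of _ "{..<n} \<times> {..<n}"]) auto
    then show "finite ?I" using fin by blast
    show "affine_function l f" if "f \<in> ?I" for f
      using that \<beta>(1) g by (auto simp: root_map_def intro!: affine_function_diff)
    show "\<exists>p\<in>cspace l. f p \<noteq> 0" if "f \<in> ?I" for f
      using that
    proof
      assume "f \<in> \<beta> ` \<B>"
      then obtain H where H: "H \<in> \<B>" "f = \<beta> H" by blast
      have "trunc l (T w) \<notin> H" using x0 H by (auto simp: arr_complement_def)
      then have "f (trunc l (T w)) \<noteq> 0" using \<beta>(2)[OF H(1)] H(2) trunc_in_cspace by blast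
      then show ?thesis using trunc_in_cspace by blast
    next
      assume "f \<in> (\<lambda>(i, j) x. g x i - g x j) ` ?D"
      then show ?thesis
        using root_functions_distinct[OF T g arr card w] by fastforce
    qed
  qed (use zero_in_cspace cspace_translate in blast)+
  then obtain x where x: "x \<in> cspace l" "\<forall>f\<in>?I. f x \<noteq> 0" by blast
  have "x \<notin> H" if "H \<in> \<B>" for H
    using x(2) that \<beta>(2)[OF that] by blast
  then have "x \<in> arr_complement l \<B>" using x(1) by (auto simp: arr_complement_def)
  moreover have "inj_on (g x) {..<n}"
  proof (rule inj_onI, rule ccontr)
    fix i j assume "i \<in> {..<n}" "j \<in> {..<n}" "g x i = g x j" "i \<noteq> j"
    then have "(\<lambda>x. g x i - g x j) \<in> ?I" by (intro UnI2 image_eqI[of _ _ "(i, j)"]) auto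
    with x(2) have "g x i - g x j \<noteq> 0" by (rule bspec)
    then show False using \<open>g x i = g x j\<close> by simp
  qed
  ultimately show ?thesis by blast
qed

section \<open>Fibers of the bundle and their punctures\<close>

lemma fiber_bundle_fiber_homeomorphic:
  assumes "fiber_bundle p E X F" "b \<in> X"
  shows "{e \<in> E. p e = b} homeomorphic F"
proof -
  obtain U h h' where U: "b \<in> U" and hom: "homeomorphism {e \<in> E. p e \<in> U} (U \<times> F) h h'"
      and fst: "\<And>e. e \<in> E \<Longrightarrow> p e \<in> U \<Longrightarrow> fst (h e) = p e"
    using assms unfolding fiber_bundle_def by meson
  have h'_in: "h' (b, y) \<in> {e \<in> E. p e \<in> U}" if "y \<in> F" for y
    using homeomorphism_image2[OF hom] U that by blast
  have h_in: "h e \<in> U \<times> F" if "e \<in> E" "p e = b" for e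
    using homeomorphism_image1[OF hom] U that by blast
  have h_eq: "h e = (b, snd (h e))" if "e \<in> E" "p e = b" for e
    using fst[of e] that U by (metis prod.collapse)
  have hh': "h (h' (b, y)) = (b, y)" if "y \<in> F" for y
    using homeomorphism_apply2[OF hom] U that by blast
  have "homeomorphism {e \<in> E. p e = b} F (\<lambda>e. snd (h e)) (\<lambda>y. h' (b, y))"
  proof (intro homeomorphismI image_subsetI)
    have "continuous_on {e \<in> E. p e = b} h"
      using U by (intro continuous_on_subset[OF homeomorphism_cont1[OF hom]]) auto
    then show "continuous_on {e \<in> E. p e = b} (\<lambda>e. snd (h e))"
      by (rule continuous_on_snd)
    show "continuous_on F (\<lambda>y. h' (b, y))"
      using U by (intro continuous_on_compose2[OF homeomorphism_cont2[OF hom]] continuous_intros) auto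
    show "snd (h e) \<in> F" if "e \<in> {e \<in> E. p e = b}" for e
      using h_in[of e] that by (auto simp: mem_Times_iff)
    show "h' (b, y) \<in> {e \<in> E. p e = b}" if "y \<in> F" for y
      using h'_in[OF that] fst[of "h' (b, y)"] hh'[OF that] by simp
    show "h' (b, snd (h e)) = e" if "e \<in> {e \<in> E. p e = b}" for e
      using h_eq[of e] homeomorphism_apply1[OF hom, of e] that U by simp
    show "snd (h (h' (b, y))) = y" if "y \<in> F" for y
      using hh'[OF that] by simp
  qed
  then show ?thesis unfolding homeomorphic_def by blast
qed

lemma fiber_homeomorphic_punctured_plane:
  assumes T: "affine_coordinates (Suc l) T" and g: "root_map l n T \<A> \<B> g"
    and fin: "finite \<A>" "finite \<B>" and x: "x \<in> arr_complement l \<B>"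
  shows "{v \<in> arr_complement (Suc l) \<A>. bundle_projection l T v = x} homeomorphic - (g x ` {..<n})"
    (is "?F homeomorphic ?C")
proof -
  let ?T' = "inv_into (cspace (Suc l)) T"
  have bij: "bij_betw T (cspace (Suc l)) (cspace (Suc l))"
    using T by (simp add: affine_coordinates_def)
  note T' = affine_coordinates_inv_into[OF T]
  have xl: "x \<in> cspace l" using x by (simp add: arr_complement_def)
  have up: "x(l := z) \<in> cspace (Suc l)" for z by (rule fun_upd_in_cspace[OF xl])
  have TT': "T (?T' (x(l := z))) = x(l := z)" for z
    using bij_betw_inv_into_right[OF bij up] .
  have F: "v \<in> cspace (Suc l)" "trunc l (T v) = x" if "v \<in> ?F" for v
    using that by (auto simp: arr_complement_def bundle_projection_def)
  have "homeomorphism ?F ?C (\<lambda>v. T v l) (\<lambda>z. ?T' (x(l := z)))"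
  proof (intro homeomorphismI image_subsetI)
    have "continuous_on ?F T"
      using F(1) by (intro continuous_on_subset[OF continuous_on_affine_coordinates[OF T]]) blast
    then show "continuous_on ?F (\<lambda>v. T v l)" by (rule continuous_on_product_then_coordinatewise)
    show "continuous_on ?C (\<lambda>z. ?T' (x(l := z)))"
      using up by (intro continuous_on_compose2[OF continuous_on_affine_coordinates[OF T']]
          continuous_on_fun_upd continuous_intros) blast
    show "T v l \<in> ?C" if "v \<in> ?F" for v
      using root_map_arr_complement_iff[OF g fin F(1)[OF that]] F(2)[OF that] that by simp
    show "?T' (x(l := z)) \<in> ?F" if "z \<in> ?C" for z
      using root_map_arr_complement_iff[OF g fin affine_coordinates_in_cspace[OF T' up], of z] that x
      by (simp add: TT' trunc_fun_upd[OF xl] bundle_projection_def)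
    show "?T' (x(l := T v l)) = v" if "v \<in> ?F" for v
      using trunc_fun_upd_last[OF affine_coordinates_in_cspace[OF T F(1)[OF that]]] F(2)[OF that]
        bij_betw_inv_into_left[OF bij F(1)[OF that]] by simp
    show "T (?T' (x(l := z))) l = z" for z by (simp add: TT')
  qed
  then show ?thesis unfolding homeomorphic_def by blast
qed

text \<open>
  The fibers over \<open>x\<close> and over a point with \<open>n\<close> distinct roots are homeomorphic,
  so they have the same number of punctures.
\<close>

lemma root_map_in_configuration_space:
  assumes arr: "arrangement l \<B>" "arrangement (Suc l) \<A>" and card: "card \<A> = card \<B> + n"
    and fib: "strictly_linearly_fibered_via l T \<A> \<B>" and g: "root_map l n T \<A> \<B> g"
    and x: "x \<in> arr_complement l \<B>"
  shows "g x \<in> configuration_space n"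
proof -
  have fin: "finite \<A>" "finite \<B>" using arr by (auto simp: arrangement_def)
  obtain S :: "complex set" where T: "affine_coordinates (Suc l) T" and
    fb: "fiber_bundle (bundle_projection l T) (arr_complement (Suc l) \<A>) (arr_complement l \<B>) (- S)"
    using fib unfolding strictly_linearly_fibered_via_def by blast
  \<comment> \<open>Surjectivity of the projection over x supplies a point of M(\<A>), which the
    counting argument requires.\<close>
  have "x \<in> bundle_projection l T ` arr_complement (Suc l) \<A>"
    using fb x by (simp add: fiber_bundle_def)
  then obtain w where w: "w \<in> arr_complement (Suc l) \<A>" by blast
  obtain y where y: "y \<in> arr_complement l \<B>" "inj_on (g y) {..<n}"
    using exists_generic_distinct_roots[OF T g arr card w] by blast
  \<comment> \<open>Any two fibers are compared through the model fiber \<open>- S\<close>, whatever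
    the size of S.\<close>
  have hom: "- (g u ` {..<n}) homeomorphic - S" if "u \<in> arr_complement l \<B>" for u
    using fiber_homeomorphic_punctured_plane[OF T g fin that] fiber_bundle_fiber_homeomorphic[OF fb that]
    by (meson homeomorphic_sym homeomorphic_trans)
  have "- (g x ` {..<n}) homeomorphic - (g y ` {..<n})"
    using hom[OF x] hom[OF y(1)] by (meson homeomorphic_sym homeomorphic_trans)
  then have "card (g x ` {..<n}) = card (g y ` {..<n})"
    by (intro homeomorphic_punctured_planes_card_eq) auto
  \<comment> \<open>The n indices yield n different values, so no two roots coincide.\<close>
  then have "inj_on (g x) {..<n}"
    using card_image[OF y(2)] by (intro eq_card_imp_inj_on) auto
  moreover have "g x \<in> cspace n"
    using g x by (auto simp: root_map_def arr_complement_def)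
  ultimately show ?thesis by (simp add: configuration_space_def)
qed

section \<open>Equivalence with the pullback of the configuration space bundle\<close>

lemma configuration_space_fun_upd:
  assumes "y \<in> configuration_space n" "z \<notin> y ` {..<n}"
  shows "y(n := z) \<in> configuration_space (Suc n)"
  using assms by (auto simp: configuration_space_def fun_upd_in_cspace lessThan_Suc inj_on_def)

lemma configuration_space_SucD:
  assumes "d \<in> configuration_space (Suc n)"
  shows "d n \<notin> trunc n d ` {..<n}"
proof
  assume "d n \<in> trunc n d ` {..<n}"
  then obtain i where i: "i < n" "d i = d n" by (auto simp: trunc_def)
  have "inj_on d {..<Suc n}" using assms by (simp add: configuration_space_def)
  from inj_onD[OF this i(2)] i(1) show False by simp
qed

theorem theorem1p1p5:
  fixes l m n :: nat
    and \<A> \<B> :: "(nat \<Rightarrow> complex) set set"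
    and T g :: "(nat \<Rightarrow> complex) \<Rightarrow> nat \<Rightarrow> complex"
  assumes "arrangement l \<B>" and "card \<B> = m"
    and "arrangement (Suc l) \<A>" and "card \<A> = m + n"
    and "strictly_linearly_fibered_via l T \<A> \<B>"
    and "root_map l n T \<A> \<B> g"
  shows "g ` arr_complement l \<B> \<subseteq> configuration_space n \<and>
    bundle_equivalent
      (bundle_projection l T) (arr_complement (Suc l) \<A>)
      fst (pullback_space g (arr_complement l \<B>) (trunc n) (configuration_space (Suc n)))"
proof
  note g = assms(6)
  have conf: "g x \<in> configuration_space n" if "x \<in> arr_complement l \<B>" for x
    using root_map_in_configuration_space[OF assms(1,3) _ assms(5,6) that] assms(2,4) by simp
  then show "g ` arr_complement l \<B> \<subseteq> configuration_space n" by blast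
  have fin: "finite \<A>" "finite \<B>" using assms(1,3) by (auto simp: arrangement_def)
  have T: "affine_coordinates (Suc l) T"
    using assms(5) by (simp add: strictly_linearly_fibered_via_def)
  then have bij: "bij_betw T (cspace (Suc l)) (cspace (Suc l))"
    by (simp add: affine_coordinates_def)
  let ?T' = "inv_into (cspace (Suc l)) T"
  note T' = affine_coordinates_inv_into[OF T]
  let ?E = "arr_complement (Suc l) \<A>" and ?X = "arr_complement l \<B>"
  let ?D = "pullback_space g ?X (trunc n) (configuration_space (Suc n))"
  \<comment> \<open>A point of the pullback is x with a configuration whose first n entries are
    already g(x). So the inverse reads back only x and entry n, the value z, which becomes
    coordinate l; both are last positions since indices start at 0.\<close>
  let ?\<Phi> = "\<lambda>v. (trunc l (T v), (g (trunc l (T v)))(n := T v l))"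
  let ?\<Psi> = "\<lambda>e. ?T' ((fst e)(l := snd e n))"
  have E: "v \<in> cspace (Suc l)" "trunc l (T v) \<in> ?X" "T v l \<notin> g (trunc l (T v)) ` {..<n}"
    if "v \<in> ?E" for v
  proof -
    show v: "v \<in> cspace (Suc l)" using that by (simp add: arr_complement_def)
    show "trunc l (T v) \<in> ?X" "T v l \<notin> g (trunc l (T v)) ` {..<n}"
      using root_map_arr_complement_iff[OF g fin v] that by auto
  qed
  have X: "x \<in> cspace l" "g x \<in> cspace n" if "x \<in> ?X" for x
    using that conf[OF that] by (auto simp: arr_complement_def configuration_space_def)
  have D: "fst e \<in> ?X" "g (fst e) = trunc n (snd e)" "snd e \<in> configuration_space (Suc n)"
    if "e \<in> ?D" for e
    using that by (auto simp: pullback_space_def)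
  have up: "(fst e)(l := snd e n) \<in> cspace (Suc l)" if "e \<in> ?D" for e
    using fun_upd_in_cspace X(1) D(1)[OF that] by blast
  have TT': "T (?\<Psi> e) = (fst e)(l := snd e n)" if "e \<in> ?D" for e
    using bij_betw_inv_into_right[OF bij up[OF that]] .
  have "homeomorphism ?E ?D ?\<Phi> ?\<Psi>"
  proof (intro homeomorphismI image_subsetI)
    have contT: "continuous_on ?E T"
      using E(1) by (intro continuous_on_subset[OF continuous_on_affine_coordinates[OF T]]) blast
    have "continuous_on (cspace l) (\<lambda>x. g x j)" if "j < n" for j
      using g that by (intro continuous_on_affine_function) (simp add: root_map_def)
    then have "continuous_on ?X (\<lambda>x. g x j)" if "j < n" for j
      using that X(1) by (meson continuous_on_subset subsetI)
    moreover have "continuous_on ?X (\<lambda>x. g x j)" if "\<not> j < n" for j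
    proof -
      have "g x j = 0" if "x \<in> ?X" for x
        using X(2)[OF that] \<open>\<not> j < n\<close> by (simp add: cspace_def)
      then show ?thesis by (simp cong: continuous_on_cong)
    qed
    ultimately have contg: "continuous_on ?X g"
      by (intro continuous_on_coordinatewise_then_product) blast
    show "continuous_on ?E ?\<Phi>"
      using E(2) by (intro continuous_on_Pair continuous_on_fun_upd continuous_on_trunc contT
          continuous_on_compose2[OF contg] continuous_on_product_then_coordinatewise[OF contT]) blast
    show "continuous_on ?D ?\<Psi>"
      using up by (intro continuous_on_compose2[OF continuous_on_affine_coordinates[OF T']]
          continuous_on_fun_upd continuous_on_product_then_coordinatewise[where f = snd]
          continuous_on_fst continuous_on_snd continuous_on_id) blast
    \<comment> \<open>Distinctness of the roots enters here through \<open>conf\<close>: it makes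
      (g(x), z) a configuration.\<close>
    show "?\<Phi> v \<in> ?D" if "v \<in> ?E" for v
      using E[OF that] X(2) conf configuration_space_fun_upd
      by (simp add: pullback_space_def trunc_fun_upd)
    \<comment> \<open>The last entry of the configuration differs from the first n, which are the
      roots over x; hence z avoids the roots.\<close>
    show "?\<Psi> e \<in> ?E" if "e \<in> ?D" for e
      using root_map_arr_complement_iff[OF g fin affine_coordinates_in_cspace[OF T' up[OF that]]]
        D[OF that] configuration_space_SucD[of "snd e" n] X(1)
      by (simp add: TT'[OF that] trunc_fun_upd)
    show "?\<Psi> (?\<Phi> v) = v" if "v \<in> ?E" for v
      using trunc_fun_upd_last[OF affine_coordinates_in_cspace[OF T E(1)[OF that]]]
        bij_betw_inv_into_left[OF bij E(1)[OF that]] by simp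
    show "?\<Phi> (?\<Psi> e) = e" if "e \<in> ?D" for e
      using D[OF that] X(1) trunc_fun_upd_last[of "snd e" n]
      by (simp add: TT'[OF that] trunc_fun_upd configuration_space_def)
  qed
  then show "bundle_equivalent (bundle_projection l T) ?E fst ?D"
    unfolding bundle_equivalent_def by (force simp: bundle_projection_def)
qed

end
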